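(* Let $U,V\subset\mathbb{C}$ be bounded domains and let $\phi\colon U\to V$ be a conformal bi-Hölder map. Then $U$ and $V$ are Schwartz equivalent.
   Context: A domain is an open connected subset of $\mathbb{C}$. A conformal map $U\to V$ is a biholomorphism of $U$ onto $V$. A map $\phi\colon U\to V$ is Hölder if there are $C,\alpha>0$ with $|\phi(x)-\phi(y)|\le C|x-y|^\alpha$ for all $x,y\in U$; it is bi-Hölder if it is invertible and both it and its inverse are Hölder. Identify $\mathbb{C}$ with $\mathbb{R}^2$. $\mathcal{S}(\mathbb{R}^n)$ is the usual Fréchet space of real-valued Schwartz functions on $\mathbb{R}^n$. For an open $U\subset\mathbb{R}^n$, $\mathcal{S}(U)$ is the closed subspace of those $f\in\mathcal{S}(\mathbb{R}^n)$ such that $f$ and all its partial derivatives vanish at every point of $\mathbb{R}^n\setminus U$, with the induced Fréchet topology; its elements are regarded (by restriction) as smooth functions on $U$. Two open subsets $U,V\subset\mathbb{R}^n$ are called Schwartz equivalent if there exists a $C^\infty$-diffeomorphism $\phi\colon U\to V$ such that $s\mapsto s\circ\phi$ is an isomorphism of Fréchet spaces $\mathcal{S}(V)\to\mathcal{S}(U)$. *)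

theory Defs
  imports "HOL-Analysis.Analysis"
begin

text \<open>
  Iterated partial derivatives are indexed by lists of vectors of \<^const>\<open>Basis\<close>. For the
  smooth functions to which they are applied below, they do not depend on the order of the
  list, so this agrees with the usual multi-indices. The plane is the type \<^typ>\<open>complex\<close>,
  which is a two-dimensional Euclidean space with basis \<open>1\<close>, \<open>\<i>\<close>.
\<close>

fun iter_pderiv :: "'a::euclidean_space list \<Rightarrow> ('a \<Rightarrow> 'b::real_normed_vector) \<Rightarrow> 'a \<Rightarrow> 'b" where
  "iter_pderiv [] f = f"
| "iter_pderiv (b # bs) f = (\<lambda>x. frechet_derivative (iter_pderiv bs f) (at x) b)"

text \<open>\<open>C\<^sup>\<infinity>\<close> functions on an open set; values off the set play no role.\<close>

definition smooth_on :: "'a::euclidean_space set \<Rightarrow> ('a \<Rightarrow> 'b::real_normed_vector) \<Rightarrow> bool" where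
  "smooth_on U f \<longleftrightarrow>
     (\<forall>bs. set bs \<subseteq> Basis \<longrightarrow> (\<forall>x\<in>U. iter_pderiv bs f differentiable (at x)))"

definition diffeomorphism_betw ::
    "'a::euclidean_space set \<Rightarrow> 'a set \<Rightarrow> ('a \<Rightarrow> 'a) \<Rightarrow> bool" where
  "diffeomorphism_betw U V \<phi> \<longleftrightarrow>
     bij_betw \<phi> U V \<and> smooth_on U \<phi> \<and> smooth_on V (inv_into U \<phi>)"

definition schwartz_space :: "('a::euclidean_space \<Rightarrow> real) set" where
  "schwartz_space = {f. smooth_on UNIV f \<and>
     (\<forall>k bs. set bs \<subseteq> Basis \<longrightarrow> bounded (range (\<lambda>x. norm x ^ k * \<bar>iter_pderiv bs f x\<bar>)))}"

definition schwartz_seminorm ::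
    "nat \<Rightarrow> 'a::euclidean_space list \<Rightarrow> ('a \<Rightarrow> real) \<Rightarrow> real" where
  "schwartz_seminorm k bs f = (SUP x. norm x ^ k * \<bar>iter_pderiv bs f x\<bar>)"

text \<open>
  The Frechet topology: the locally convex topology defined by the countable family of
  seminorms above, given by the open seminorm balls as a subbase.
\<close>

definition schwartz_topology :: "('a::euclidean_space \<Rightarrow> real) topology" where
  "schwartz_topology = topology_generated_by
     {{g \<in> schwartz_space. schwartz_seminorm k bs (\<lambda>x. g x - f x) < e} |f k bs e.
        f \<in> schwartz_space \<and> set bs \<subseteq> Basis \<and> e > 0}"

lemma topspace_schwartz_topology:
  "topspace (schwartz_topology :: ('a::euclidean_space \<Rightarrow> real) topology) = schwartz_space"
proof (rule equalityI)
  show "topspace schwartz_topology \<subseteq> (schwartz_space :: ('a \<Rightarrow> real) set)"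
    unfolding schwartz_topology_def topology_generated_by_topspace by blast
  show "(schwartz_space :: ('a \<Rightarrow> real) set) \<subseteq> topspace schwartz_topology"
  proof
    fix f :: "'a \<Rightarrow> real" assume f: "f \<in> schwartz_space"
    then have "f \<in> {g \<in> schwartz_space. schwartz_seminorm 0 [] (\<lambda>x. g x - f x) < 1}"
      by (simp add: schwartz_seminorm_def)
    moreover have "set ([] :: 'a list) \<subseteq> Basis" "(1::real) > 0"
      by simp_all
    ultimately show "f \<in> topspace schwartz_topology"
      unfolding schwartz_topology_def topology_generated_by_topspace using f by blast
  qed
qed

definition schwartz_space_on :: "'a::euclidean_space set \<Rightarrow> ('a \<Rightarrow> real) set" where
  "schwartz_space_on U =
     {f \<in> schwartz_space. \<forall>bs. set bs \<subseteq> Basis \<longrightarrow> (\<forall>x. x \<notin> U \<longrightarrow> iter_pderiv bs f x = 0)}"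

definition schwartz_topology_on :: "'a::euclidean_space set \<Rightarrow> ('a \<Rightarrow> real) topology" where
  "schwartz_topology_on U = subtopology schwartz_topology (schwartz_space_on U)"

lemma topspace_schwartz_topology_on:
  "topspace (schwartz_topology_on U) = schwartz_space_on U"
  by (auto simp: schwartz_topology_on_def topspace_schwartz_topology schwartz_space_on_def)

text \<open>
  An element of \<open>schwartz_space_on U\<close> vanishes off \<open>U\<close>, hence is determined by its restriction
  to \<open>U\<close>. Accordingly, the function \<open>s \<circ> \<phi>\<close> on \<open>U\<close> is represented by its extension by zero.
\<close>

definition schwartz_pullback ::
    "'a::euclidean_space set \<Rightarrow> ('a \<Rightarrow> 'a) \<Rightarrow> ('a \<Rightarrow> real) \<Rightarrow> 'a \<Rightarrow> real" where
  "schwartz_pullback U \<phi> s = (\<lambda>x. if x \<in> U then s (\<phi> x) else 0)"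

text \<open>Isomorphisms of topological vector spaces of real functions with pointwise operations.\<close>

definition tvs_isomorphism ::
    "('a \<Rightarrow> real) topology \<Rightarrow> ('b \<Rightarrow> real) topology \<Rightarrow> (('a \<Rightarrow> real) \<Rightarrow> 'b \<Rightarrow> real) \<Rightarrow> bool" where
  "tvs_isomorphism X Y T \<longleftrightarrow>
     (\<forall>f\<in>topspace X. \<forall>g\<in>topspace X. T (\<lambda>x. f x + g x) = (\<lambda>y. T f y + T g y)) \<and>
     (\<forall>c. \<forall>f\<in>topspace X. T (\<lambda>x. c * f x) = (\<lambda>y. c * T f y)) \<and>
     homeomorphic_map X Y T"

definition schwartz_equivalent :: "'a::euclidean_space set \<Rightarrow> 'a set \<Rightarrow> bool" where
  "schwartz_equivalent U V \<longleftrightarrow>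
     open U \<and> open V \<and>
     (\<exists>\<phi>. diffeomorphism_betw U V \<phi> \<and>
          tvs_isomorphism (schwartz_topology_on V) (schwartz_topology_on U)
            (schwartz_pullback U \<phi>))"

definition planar_domain :: "complex set \<Rightarrow> bool" where
  "planar_domain U \<longleftrightarrow> open U \<and> connected U"

definition conformal_map :: "complex set \<Rightarrow> complex set \<Rightarrow> (complex \<Rightarrow> complex) \<Rightarrow> bool" where
  "conformal_map U V \<phi> \<longleftrightarrow>
     bij_betw \<phi> U V \<and> \<phi> holomorphic_on U \<and> inv_into U \<phi> holomorphic_on V"

definition hoelder_on :: "'a::metric_space set \<Rightarrow> ('a \<Rightarrow> 'b::metric_space) \<Rightarrow> bool" where
  "hoelder_on U \<phi> \<longleftrightarrow>
     (\<exists>C>0. \<exists>\<alpha>>0. \<forall>x\<in>U. \<forall>y\<in>U. dist (\<phi> x) (\<phi> y) \<le> C * dist x y powr \<alpha>)"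

definition bi_hoelder ::
    "'a::metric_space set \<Rightarrow> 'b::metric_space set \<Rightarrow> ('a \<Rightarrow> 'b) \<Rightarrow> bool" where
  "bi_hoelder U V \<phi> \<longleftrightarrow>
     bij_betw \<phi> U V \<and> hoelder_on U \<phi> \<and> hoelder_on V (inv_into U \<phi>)"

end

theory Submission
  imports Defs "HOL-Complex_Analysis.Complex_Analysis"
begin

text \<open>
  A function \<open>s\<close> in the Schwartz space of \<open>V\<close> vanishes at the boundary with all its derivatives,
  so by Taylor's theorem each derivative of \<open>s\<close> is dominated by any power of the distance to the
  complement of \<open>V\<close>. Since \<open>\<phi>\<close> is Hoelder, the distance of \<open>\<phi> x\<close> to the complement of \<open>V\<close> is
  dominated by a power of the distance \<open>\<delta>\<close> of \<open>x\<close> to the complement of \<open>U\<close>. As \<open>\<phi>\<close> is bounded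
  and holomorphic, Cauchy's inequality bounds its derivatives by negative powers of \<open>\<delta>\<close>. In the
  chain rule for \<open>s \<circ> \<phi>\<close> the decay of \<open>s\<close> therefore beats the blow-up of the derivatives of \<open>\<phi>\<close>,
  the extension of \<open>s \<circ> \<phi>\<close> by zero is smooth, and its seminorms are bounded by those of \<open>s\<close>.
  The same applies to the inverse map.
\<close>

section \<open>Schwartz functions\<close>

lemma iter_pderiv_diff:
  assumes "smooth_on UNIV f" and "smooth_on UNIV g" and "set bs \<subseteq> Basis"
  shows "iter_pderiv bs (\<lambda>x. f x - g x) = (\<lambda>x. iter_pderiv bs f x - iter_pderiv bs g x)"
  using assms(3)
proof (induction bs)
  case (Cons b bs)
  have "((\<lambda>x. iter_pderiv bs f x - iter_pderiv bs g x) has_derivative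
      (\<lambda>h. frechet_derivative (iter_pderiv bs f) (at x) h
         - frechet_derivative (iter_pderiv bs g) (at x) h)) (at x)" for x
    using assms(1,2) Cons.prems
    by (intro has_derivative_diff) (auto simp: smooth_on_def simp flip: frechet_derivative_works)
  from frechet_derivative_at[OF this, symmetric] show ?case
    using Cons by simp
qed simp

lemma schwartz_space_diff:
  assumes f: "f \<in> schwartz_space" and g: "g \<in> schwartz_space"
  shows "(\<lambda>x. f x - g x) \<in> schwartz_space"
proof -
  have sm: "smooth_on UNIV f" "smooth_on UNIV g"
    using f g by (auto simp: schwartz_space_def)
  have "smooth_on UNIV (\<lambda>x. f x - g x)"
    unfolding smooth_on_def
  proof (intro allI impI ballI)
    fix bs :: "'a list" and x :: 'a
    assume bs: "set bs \<subseteq> Basis"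
    show "iter_pderiv bs (\<lambda>x. f x - g x) differentiable at x"
      unfolding iter_pderiv_diff[OF sm bs]
      using sm bs by (intro differentiable_diff) (auto simp: smooth_on_def)
  qed
  moreover have "bounded (range (\<lambda>x. norm x ^ k * \<bar>iter_pderiv bs (\<lambda>x. f x - g x) x\<bar>))"
    if bs: "set bs \<subseteq> Basis" for k bs
  proof -
    have "bounded (range (\<lambda>x. norm x ^ k * \<bar>iter_pderiv bs f x\<bar>))"
      "bounded (range (\<lambda>x. norm x ^ k * \<bar>iter_pderiv bs g x\<bar>))"
      using f g bs by (auto simp: schwartz_space_def)
    then obtain A B where A: "\<And>x. norm x ^ k * \<bar>iter_pderiv bs f x\<bar> \<le> A"
      and B: "\<And>x. norm x ^ k * \<bar>iter_pderiv bs g x\<bar> \<le> B"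
      unfolding bounded_iff by (auto simp: abs_mult)
    have "norm x ^ k * \<bar>iter_pderiv bs f x - iter_pderiv bs g x\<bar> \<le> A + B" for x
    proof -
      have "norm x ^ k * \<bar>iter_pderiv bs f x - iter_pderiv bs g x\<bar>
          \<le> norm x ^ k * (\<bar>iter_pderiv bs f x\<bar> + \<bar>iter_pderiv bs g x\<bar>)"
        by (intro mult_left_mono) auto
      with A[of x] B[of x] show ?thesis
        by (simp add: distrib_left)
    qed
    then show ?thesis
      unfolding iter_pderiv_diff[OF sm bs] bounded_iff
      by (auto simp: abs_mult intro!: exI[of _ "A + B"])
  qed
  ultimately show ?thesis
    by (simp add: schwartz_space_def)
qed

lemma schwartz_space_on_diff:
  assumes "f \<in> schwartz_space_on U" and "g \<in> schwartz_space_on U"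
  shows "(\<lambda>x. f x - g x) \<in> schwartz_space_on U"
  using assms schwartz_space_diff[of f g] iter_pderiv_diff[of f g]
  by (auto simp: schwartz_space_on_def schwartz_space_def)

lemma schwartz_seminorm_upper:
  assumes "f \<in> schwartz_space" and "set bs \<subseteq> Basis"
  shows "norm x ^ k * \<bar>iter_pderiv bs f x\<bar> \<le> schwartz_seminorm k bs f"
  unfolding schwartz_seminorm_def using assms
  by (intro cSUP_upper) (auto simp: schwartz_space_def intro: bounded_imp_bdd_above)

lemma schwartz_seminorm_nonneg:
  assumes "f \<in> schwartz_space" and "set bs \<subseteq> Basis"
  shows "0 \<le> schwartz_seminorm k bs f"
  by (rule order_trans[OF _ schwartz_seminorm_upper[OF assms, of 0]]) simp

lemma schwartz_seminorm_triangle: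
  assumes "f \<in> schwartz_space" "g \<in> schwartz_space" "h \<in> schwartz_space" and bs: "set bs \<subseteq> Basis"
  shows "schwartz_seminorm k bs (\<lambda>x. f x - h x)
    \<le> schwartz_seminorm k bs (\<lambda>x. f x - g x) + schwartz_seminorm k bs (\<lambda>x. g x - h x)"
proof -
  let ?D = "iter_pderiv bs"
  have sm: "smooth_on UNIV f" "smooth_on UNIV g" "smooth_on UNIV h"
    using assms by (auto simp: schwartz_space_def)
  have "norm x ^ k * \<bar>?D (\<lambda>x. f x - h x) x\<bar>
      \<le> schwartz_seminorm k bs (\<lambda>x. f x - g x) + schwartz_seminorm k bs (\<lambda>x. g x - h x)" for x
  proof -
    have "norm x ^ k * \<bar>?D (\<lambda>x. f x - h x) x\<bar>
        \<le> norm x ^ k * (\<bar>?D (\<lambda>x. f x - g x) x\<bar> + \<bar>?D (\<lambda>x. g x - h x) x\<bar>)"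
      using sm bs by (intro mult_left_mono) (auto simp: iter_pderiv_diff)
    with schwartz_seminorm_upper[OF schwartz_space_diff[OF assms(1,2)] bs, of x k]
      schwartz_seminorm_upper[OF schwartz_space_diff[OF assms(2,3)] bs, of x k]
    show ?thesis
      by (simp add: distrib_left)
  qed
  then show ?thesis
    unfolding schwartz_seminorm_def by (intro cSUP_least) auto
qed

section \<open>Norms of C^m type and decay at the boundary\<close>

text \<open>Only unweighted seminorms enter, since the weights are bounded on a bounded set. As the
  sum runs over lists, mixed derivatives are counted repeatedly, which affects only
  constants.\<close>

definition Cm_norm :: "nat \<Rightarrow> ('a::euclidean_space \<Rightarrow> real) \<Rightarrow> real" where
  "Cm_norm m f = (\<Sum>bs | set bs \<subseteq> Basis \<and> length bs \<le> m. schwartz_seminorm 0 bs f)"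

lemma Cm_norm_nonneg: "f \<in> schwartz_space \<Longrightarrow> 0 \<le> Cm_norm m f"
  unfolding Cm_norm_def by (intro sum_nonneg schwartz_seminorm_nonneg) auto

lemma Cm_norm_mono: "f \<in> schwartz_space \<Longrightarrow> m \<le> n \<Longrightarrow> Cm_norm m f \<le> Cm_norm n f"
  unfolding Cm_norm_def
  by (intro sum_mono2 finite_lists_length_le) (auto intro: schwartz_seminorm_nonneg)

lemma abs_iter_pderiv_le_Cm_norm:
  assumes "f \<in> schwartz_space" and "set bs \<subseteq> Basis" and "length bs \<le> m"
  shows "\<bar>iter_pderiv bs f x\<bar> \<le> Cm_norm m f"
proof -
  have "\<bar>iter_pderiv bs f x\<bar> \<le> schwartz_seminorm 0 bs f"
    using schwartz_seminorm_upper[OF assms(1,2), of x 0] by simp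
  also have "\<dots> \<le> Cm_norm m f"
    unfolding Cm_norm_def using assms
    by (intro member_le_sum finite_lists_length_le) (auto intro: schwartz_seminorm_nonneg)
  finally show ?thesis .
qed

text \<open>Induction on \<open>N\<close> for all derivatives at once. A derivative vanishes at the
  point \<open>z\<close> of the complement nearest to \<open>y\<close>, and its first partials are
  again iterated derivatives, covered by the hypothesis; the mean value inequality on the segment
  from \<open>y\<close> to \<open>z\<close> gains one factor of the distance. Each round costs a
  factor \<open>DIM('a)\<close>, from bounding the operator norm by the partials.\<close>

lemma schwartz_decay:
  fixes s :: "'a::euclidean_space \<Rightarrow> real"
  assumes "open V" and "V \<noteq> UNIV" and s: "s \<in> schwartz_space_on V" and "set bs \<subseteq> Basis"
  shows "\<bar>iter_pderiv bs s y\<bar>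
    \<le> real DIM('a) ^ N * Cm_norm (length bs + N) s * infdist y (- V) ^ N"
  using assms(4)
proof (induction N arbitrary: bs y)
  case 0
  then show ?case
    using abs_iter_pderiv_le_Cm_norm[of s bs "length bs" y] s by (simp add: schwartz_space_on_def)
next
  case (Suc N)
  have sS: "s \<in> schwartz_space" and van: "\<And>x. x \<notin> V \<Longrightarrow> iter_pderiv bs s x = 0"
    using s Suc.prems by (auto simp: schwartz_space_on_def)
  let ?g = "iter_pderiv bs s"
  let ?D = "\<lambda>w. frechet_derivative ?g (at w)"
  let ?d = "infdist y (- V)"
  let ?K = "real DIM('a) ^ N * Cm_norm (length bs + Suc N) s"
  have K: "0 \<le> ?K"
    using Cm_norm_nonneg[OF sS] by simp
  obtain z where z: "z \<in> - V" "infdist y (- V) = dist y z"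
    using infdist_attains_inf[of "- V" y] assms by auto
  have der: "(?g has_derivative ?D w) (at w)" for w
    using sS Suc.prems
    by (auto simp: schwartz_space_def smooth_on_def simp flip: frechet_derivative_works)
  have on: "onorm (?D w) \<le> real DIM('a) * (?K * ?d ^ N)" if w: "w \<in> closed_segment y z" for w
  proof (rule onorm_le)
    fix h :: 'a
    have lin: "linear (?D w)"
      using der has_derivative_linear by blast
    \<comment> \<open>Every point of the segment is at least as close to \<open>z\<close> as
      \<open>y\<close> is.\<close>
    have "infdist w (- V) \<le> dist w z"
      by (rule infdist_le[OF z(1)])
    also have "\<dots> \<le> ?d"
      using w z(2) by (metis closed_segment_commute dist_commute dist_in_closed_segment)
    finally have dw: "infdist w (- V) \<le> ?d" .
    have b: "\<bar>?D w b\<bar> \<le> ?K * ?d ^ N" if "b \<in> Basis" for b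
    proof -
      \<comment> \<open>At \<open>b # bs\<close> the hypothesis involves the order
        \<open>length bs + 1 + N\<close>, the one occurring in \<open>?K\<close>.\<close>
      have "\<bar>?D w b\<bar> \<le> ?K * infdist w (- V) ^ N"
        using Suc.IH[of "b # bs" w] that Suc.prems by simp
      also have "\<dots> \<le> ?K * ?d ^ N"
        using K dw by (intro mult_left_mono power_mono infdist_nonneg) auto
      finally show ?thesis .
    qed
    have "?D w h = ?D w (\<Sum>b\<in>Basis. (h \<bullet> b) *\<^sub>R b)"
      by (simp add: euclidean_representation)
    also have "\<dots> = (\<Sum>b\<in>Basis. (h \<bullet> b) * ?D w b)"
      by (simp add: linear_sum[OF lin] linear_scale[OF lin])
    finally have "\<bar>?D w h\<bar> \<le> (\<Sum>b\<in>Basis. \<bar>(h \<bullet> b) * ?D w b\<bar>)"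
      by (simp add: sum_abs)
    also have "\<dots> \<le> (\<Sum>b\<in>(Basis :: 'a set). norm h * (?K * ?d ^ N))"
      unfolding abs_mult by (intro sum_mono mult_mono Basis_le_norm b) auto
    finally show "norm (?D w h) \<le> real DIM('a) * (?K * ?d ^ N) * norm h"
      by (simp add: algebra_simps)
  qed
  have "norm (?g y - ?g z) \<le> real DIM('a) * (?K * ?d ^ N) * norm (y - z)"
    by (rule differentiable_bound[OF convex_closed_segment has_derivative_at_withinI[OF der] on]) auto
  moreover have "?g z = 0" "norm (y - z) = ?d"
    using z van by (auto simp: dist_norm)
  ultimately show ?case
    by (simp add: algebra_simps)
qed

section \<open>Continuity between Schwartz spaces\<close>

lemma openin_schwartz_ball:
  assumes "f \<in> schwartz_space" and "set bs \<subseteq> Basis" and "e > 0"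
  shows "openin schwartz_topology {g \<in> schwartz_space. schwartz_seminorm k bs (\<lambda>x. g x - f x) < e}"
  unfolding schwartz_topology_def by (rule topology_generated_by_Basis) (use assms in blast)

text \<open>Seminorm balls are only a subbase, so the neighbourhood is a finite intersection of
  them. The radius \<open>e\<close> is divided by the number of lists so that the sum over them
  stays below \<open>e\<close>.\<close>

lemma openin_Cm_ball:
  fixes f :: "'a::euclidean_space \<Rightarrow> real"
  assumes f: "f \<in> schwartz_space" and "e > 0"
  obtains W where "openin schwartz_topology W" "f \<in> W" "W \<subseteq> schwartz_space"
    "\<And>g. g \<in> W \<Longrightarrow> Cm_norm m (\<lambda>x. g x - f x) < e"
proof -
  let ?I = "{bs. set bs \<subseteq> (Basis :: 'a set) \<and> length bs \<le> m}"
  have fin: "finite ?I" and ne: "?I \<noteq> {}"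
    by (auto intro: finite_lists_length_le exI[of _ "[]"])
  define d where "d = e / (real (card ?I))"
  have cpos: "0 < real (card ?I)"
    using fin ne by (simp add: card_gt_0_iff)
  have d: "d > 0"
    using cpos \<open>e > 0\<close> by (simp add: d_def)
  let ?B = "\<lambda>bs. {g \<in> schwartz_space. schwartz_seminorm 0 bs (\<lambda>x. g x - f x) < d}"
  have zero: "iter_pderiv bs (\<lambda>x::'a. 0::real) = (\<lambda>x. 0)" for bs
    by (induction bs) (simp_all add: frechet_derivative_const)
  show thesis
  proof
    show "openin schwartz_topology (\<Inter>bs\<in>?I. ?B bs)"
      using fin ne f d by (intro openin_Inter openin_schwartz_ball finite_imageI) (auto intro: openin_schwartz_ball)
    show "f \<in> (\<Inter>bs\<in>?I. ?B bs)"
      using f d by (simp add: schwartz_seminorm_def zero)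
    show "(\<Inter>bs\<in>?I. ?B bs) \<subseteq> schwartz_space"
      using ne by blast
    show "Cm_norm m (\<lambda>x. g x - f x) < e" if "g \<in> (\<Inter>bs\<in>?I. ?B bs)" for g
    proof -
      have "Cm_norm m (\<lambda>x. g x - f x) < (\<Sum>bs\<in>?I. d)"
        unfolding Cm_norm_def using that fin ne by (intro sum_strict_mono) auto
      also have "\<dots> = e"
        using cpos by (simp add: d_def)
      finally show ?thesis .
    qed
  qed
qed

text \<open>The usual criterion that seminorm bounds make a linear map continuous. Linearity enters
  through differences: \<open>T t - f\<close> is estimated by way of \<open>T (t - s)\<close> and
  \<open>T s - f\<close>.\<close>

lemma continuous_map_schwartz_on:
  assumes maps: "\<And>s. s \<in> schwartz_space_on V \<Longrightarrow> T s \<in> schwartz_space_on U"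
    and diff: "\<And>s t. s \<in> schwartz_space_on V \<Longrightarrow> t \<in> schwartz_space_on V \<Longrightarrow>
      T (\<lambda>x. s x - t x) = (\<lambda>x. T s x - T t x)"
    and bnd: "\<And>k bs. set bs \<subseteq> Basis \<Longrightarrow>
      \<exists>C m. \<forall>s\<in>schwartz_space_on V. schwartz_seminorm k bs (T s) \<le> C * Cm_norm m s"
  shows "continuous_map (schwartz_topology_on V) (schwartz_topology_on U) T"
proof -
  let ?X = "schwartz_topology_on V"
  have sub: "\<And>U. schwartz_space_on U \<subseteq> schwartz_space"
    by (auto simp: schwartz_space_on_def)
  have "continuous_map ?X schwartz_topology T"
    unfolding schwartz_topology_def
  proof (rule continuous_on_generated_topo)
    fix B :: "('b \<Rightarrow> real) set"
    assume "B \<in> {{g \<in> schwartz_space. schwartz_seminorm k bs (\<lambda>x. g x - f x) < e} |f k bs e.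
        f \<in> schwartz_space \<and> set bs \<subseteq> Basis \<and> e > 0}"
    then obtain f k bs and e :: real where B: "B = {g \<in> schwartz_space. schwartz_seminorm k bs (\<lambda>x. g x - f x) < e}"
      and f: "f \<in> schwartz_space" and bs: "set bs \<subseteq> Basis" and "e > 0"
      by blast
    obtain C m where C: "\<And>s. s \<in> schwartz_space_on V \<Longrightarrow> schwartz_seminorm k bs (T s) \<le> C * Cm_norm m s"
      using bnd[OF bs] by blast
    show "openin ?X (T -` B \<inter> topspace ?X)"
    proof (subst openin_subopen, intro ballI)
      fix s assume "s \<in> T -` B \<inter> topspace ?X"
      then have s: "s \<in> schwartz_space_on V" and Ts: "T s \<in> B"
        by (auto simp: topspace_schwartz_topology_on)
      \<comment> \<open>\<open>r\<close> is the room that \<open>T s\<close> leaves inside the ball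
        about \<open>f\<close>.\<close>
      define r where "r = e - schwartz_seminorm k bs (\<lambda>x. T s x - f x)"
      have r: "r > 0"
        using Ts by (auto simp: B r_def)
      \<comment> \<open>The divisor is positive whatever the sign of \<open>C\<close>.\<close>
      obtain W where W: "openin schwartz_topology W" "s \<in> W" "W \<subseteq> schwartz_space"
        "\<And>t. t \<in> W \<Longrightarrow> Cm_norm m (\<lambda>x. t x - s x) < r / (\<bar>C\<bar> + 1)"
        using openin_Cm_ball[of s "r / (\<bar>C\<bar> + 1)" m] s r sub[THEN subsetD, OF s]
        by (auto simp: add_nonneg_pos)
      show "\<exists>W. openin ?X W \<and> s \<in> W \<and> W \<subseteq> T -` B \<inter> topspace ?X"
      proof (intro exI conjI)
        show "openin ?X (W \<inter> schwartz_space_on V)"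
          unfolding schwartz_topology_on_def using W(1) by (rule openin_subtopology_Int)
        show "s \<in> W \<inter> schwartz_space_on V"
          using W s by blast
        show "W \<inter> schwartz_space_on V \<subseteq> T -` B \<inter> topspace ?X"
        proof
          fix t assume t: "t \<in> W \<inter> schwartz_space_on V"
          have dS: "(\<lambda>x. t x - s x) \<in> schwartz_space_on V"
            using t s by (simp add: schwartz_space_on_diff)
          then have nn: "0 \<le> Cm_norm m (\<lambda>x. t x - s x)"
            using sub by (intro Cm_norm_nonneg) auto
          have "schwartz_seminorm k bs (\<lambda>x. T t x - T s x) \<le> C * Cm_norm m (\<lambda>x. t x - s x)"
            using C[OF dS] diff[of t s] t s by simp
          also have "\<dots> \<le> (\<bar>C\<bar> + 1) * Cm_norm m (\<lambda>x. t x - s x)"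
            using nn by (intro mult_right_mono) auto
          also have "\<dots> < r"
            using W(4)[of t] t by (simp add: field_simps add_nonneg_pos)
          finally have "schwartz_seminorm k bs (\<lambda>x. T t x - T s x) < r" .
          moreover have TS: "T t \<in> schwartz_space" "T s \<in> schwartz_space"
            using maps t s sub by blast+
          ultimately have "schwartz_seminorm k bs (\<lambda>x. T t x - f x) < e"
            using schwartz_seminorm_triangle[OF TS f bs, of k] by (simp add: r_def)
          with t TS show "t \<in> T -` B \<inter> topspace ?X"
            by (simp add: B topspace_schwartz_topology_on)
        qed
      qed
    qed
  next
    show "T ` topspace ?X \<subseteq> \<Union> {{g \<in> schwartz_space. schwartz_seminorm k bs (\<lambda>x. g x - f x) < e} |f k bs e.
        f \<in> schwartz_space \<and> set bs \<subseteq> Basis \<and> e > 0}"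
      using maps sub[of U]
      unfolding topology_generated_by_topspace[symmetric] schwartz_topology_def[symmetric]
        topspace_schwartz_topology topspace_schwartz_topology_on by blast
  qed
  then show ?thesis
    unfolding schwartz_topology_on_def[of U] using maps
    by (auto simp: continuous_map_in_subtopology topspace_schwartz_topology_on)
qed

section \<open>Extension by zero\<close>

text \<open>For \<open>x\<close> off \<open>U\<close>, the distance of \<open>y\<close> to the
  complement is at most \<open>norm (y - x)\<close>. The exponent 2 therefore makes the extension
  quadratically small near \<open>x\<close>, which forces the derivative zero.\<close>

lemma has_derivative_extend_zero:
  fixes h :: "'a::euclidean_space \<Rightarrow> real"
  assumes "open U" and inside: "\<And>x. x \<in> U \<Longrightarrow> (h has_derivative D x) (at x)"
    and small: "\<And>x. x \<in> U \<Longrightarrow> \<bar>h x\<bar> \<le> C * infdist x (- U) ^ 2"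
  shows "((\<lambda>x. if x \<in> U then h x else 0) has_derivative
    (if x \<in> U then D x else (\<lambda>_. 0))) (at x)"
proof (cases "x \<in> U")
  case True
  have "((\<lambda>x. if x \<in> U then h x else 0) has_derivative D x) (at x)"
    by (rule has_derivative_transform_within_open[OF inside[OF True] \<open>open U\<close> True]) simp
  with True show ?thesis by simp
next
  case False
  let ?u = "\<lambda>x. if x \<in> U then h x else 0"
  have le: "\<bar>?u y\<bar> \<le> \<bar>C\<bar> * norm (y - x) ^ 2" for y
  proof (cases "y \<in> U")
    case True
    have "infdist y (- U) \<le> norm (y - x)"
      using infdist_le[of x "- U" y] False by (simp add: dist_norm)
    then have "infdist y (- U) ^ 2 \<le> norm (y - x) ^ 2"
      by (intro power_mono infdist_nonneg)
    then have "C * infdist y (- U) ^ 2 \<le> \<bar>C\<bar> * norm (y - x) ^ 2"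
      by (intro mult_mono) auto
    with small[OF True] True show ?thesis by simp
  qed simp
  have "(?u has_derivative (\<lambda>_. 0)) (at x)"
    unfolding has_derivative_at
  proof
    have "((\<lambda>y::'a. \<bar>C\<bar> * norm y) \<longlongrightarrow> \<bar>C\<bar> * norm (0::'a)) (at 0)"
      by (intro tendsto_mult tendsto_norm tendsto_const tendsto_ident_at)
    then have lim: "((\<lambda>y::'a. \<bar>C\<bar> * norm y) \<longlongrightarrow> 0) (at 0)"
      by simp
    show "(\<lambda>y. norm (?u (x + y) - ?u x - 0) / norm y) \<midarrow>0\<rightarrow> 0"
    proof (rule tendsto_0_le[OF lim, of _ 1], intro always_eventually allI)
      fix y
      show "norm (norm (?u (x + y) - ?u x - 0) / norm y) \<le> norm (\<bar>C\<bar> * norm y) * 1"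
        using le[of "x + y"] False
        by (cases "y = 0") (simp_all add: divide_le_eq power2_eq_square mult.assoc)
    qed
  qed simp
  with False show ?thesis by simp
qed

section \<open>Conformal Hoelder maps\<close>

lemma infdist_compl_pos:
  fixes x :: "'a::heine_borel"
  assumes "open U" and "U \<noteq> UNIV" and "x \<in> U"
  shows "0 < infdist x (- U)"
  using assms infdist_pos_not_in_closed[of "- U" x] by auto

lemma ball_infdist_compl_subset: "ball x (infdist x (- U)) \<subseteq> U"
  by (metis ComplI infdist_le mem_ball not_le subsetI)

lemma higher_deriv_has_derivative:
  assumes "f holomorphic_on U" and "open U" and "x \<in> U"
  shows "((deriv ^^ n) f has_derivative (\<lambda>h. (deriv ^^ Suc n) f x * h)) (at x)"
  using holomorphic_derivI[OF holomorphic_higher_deriv[OF assms(1,2)] assms(2,3)]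
  by (simp add: has_field_derivative_def)

section \<open>Differential operators arising from the chain rule\<close>

text \<open>The constant \<open>w\<close> collects the directions of differentiation. It also yields
  imaginary parts, as Im z = Re (-i z), so real parts generate all coefficients that occur.\<close>

inductive conformal_coeff :: "(complex \<Rightarrow> complex) \<Rightarrow> (complex \<Rightarrow> real) \<Rightarrow> bool"
  for f where
  one: "conformal_coeff f (\<lambda>x. 1)"
| deriv: "conformal_coeff f (\<lambda>x. Re (w * (deriv ^^ n) f x))"
| add: "conformal_coeff f c \<Longrightarrow> conformal_coeff f d \<Longrightarrow> conformal_coeff f (\<lambda>x. c x + d x)"
| mult: "conformal_coeff f c \<Longrightarrow> conformal_coeff f d \<Longrightarrow> conformal_coeff f (\<lambda>x. c x * d x)"

text \<open>
  The operators \<open>s \<mapsto> \<Sum>\<^sub>j c\<^sub>j \<cdot> (D\<^sub>j s \<circ> f)\<close> with iterated partial derivatives \<open>D\<^sub>j\<close>: differentiating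
  \<open>s \<mapsto> s \<circ> f\<close> never leaves this class.
\<close>

inductive pullback_operator ::
    "(complex \<Rightarrow> complex) \<Rightarrow> ((complex \<Rightarrow> real) \<Rightarrow> complex \<Rightarrow> real) \<Rightarrow> bool"
  for f where
  monomial: "conformal_coeff f c \<Longrightarrow> set bs \<subseteq> Basis \<Longrightarrow>
    pullback_operator f (\<lambda>s x. c x * iter_pderiv bs s (f x))"
| add: "pullback_operator f F \<Longrightarrow> pullback_operator f G \<Longrightarrow>
    pullback_operator f (\<lambda>s x. F s x + G s x)"

text \<open>One direction of the equivalence, pulling back from \<open>V\<close> to
  \<open>U\<close>. Holomorphy and the Hoelder bound are those of \<open>f\<close>, while
  \<open>g\<close> contributes its continuity; the theorem uses the locale for \<open>\<phi>\<close>
  and, with roles exchanged, for its inverse.\<close>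

locale hoelder_conformal =
  fixes U V :: "complex set" and f g :: "complex \<Rightarrow> complex" and H \<alpha> :: real
  assumes open_U: "open U" and open_V: "open V"
    and bounded_U: "bounded U" and bounded_V: "bounded V"
    and homeo: "homeomorphism U V f g"
    and holo: "f holomorphic_on U"
    and H_pos: "0 < H" and \<alpha>_pos: "0 < \<alpha>"
    and hoelder: "x \<in> U \<Longrightarrow> y \<in> U \<Longrightarrow> dist (f x) (f y) \<le> H * dist x y powr \<alpha>"
begin

abbreviation \<delta> :: "complex \<Rightarrow> real" where "\<delta> x \<equiv> infdist x (- U)"

text \<open>\<open>infdist\<close> to the empty set is 0 by convention, so the distance estimates
  require nonempty complements.\<close>

lemma U_neq: "U \<noteq> UNIV" and V_neq: "V \<noteq> UNIV"
  using bounded_U bounded_V not_bounded_UNIV by auto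

lemma f_in: "x \<in> U \<Longrightarrow> f x \<in> V"
  using homeo by (auto simp: homeomorphism_def)

lemma \<delta>_pos: "x \<in> U \<Longrightarrow> 0 < \<delta> x"
  by (rule infdist_compl_pos[OF open_U U_neq])

text \<open>Lets a surplus power of \<delta> be replaced by a constant.\<close>

lemma \<delta>_bounded: obtains R where "R > 0" "\<And>x. x \<in> U \<Longrightarrow> \<delta> x \<le> R"
proof -
  obtain z where z: "z \<in> - U"
    using U_neq by blast
  obtain B where B: "\<And>x. x \<in> U \<Longrightarrow> norm x \<le> B"
    using bounded_U by (auto simp: bounded_iff)
  show thesis
  proof
    show "0 < \<bar>B\<bar> + norm z + 1"
      by (simp add: add_nonneg_pos)
    show "\<delta> x \<le> \<bar>B\<bar> + norm z + 1" if "x \<in> U" for x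
      using infdist_le[OF z, of x] B[OF that] norm_triangle_ineq4[of x z] by (simp add: dist_norm)
  qed
qed

text \<open>
  Otherwise \<open>f\<close> would map the ball around \<open>x\<close> that touches the complement of \<open>U\<close> into a compact
  ball inside \<open>V\<close>, and applying \<open>g\<close> would put the closure of the former ball inside \<open>U\<close>.
\<close>

lemma infdist_image_le:
  assumes x: "x \<in> U"
  shows "infdist (f x) (- V) \<le> H * \<delta> x powr \<alpha>"
proof (rule ccontr)
  assume neg: "\<not> ?thesis"
  define K where "K = g ` cball (f x) (H * \<delta> x powr \<alpha>)"
  \<comment> \<open>The negated inequality is strict, so even the closed ball lies in
    \<open>V\<close>.\<close>
  have sub: "cball (f x) (H * \<delta> x powr \<alpha>) \<subseteq> V"
  proof
    fix y assume "y \<in> cball (f x) (H * \<delta> x powr \<alpha>)"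
    with neg show "y \<in> V"
      using infdist_le[of y "- V" "f x"] by force
  qed
  have "compact K"
    unfolding K_def using homeo sub
    by (intro compact_continuous_image) (auto simp: homeomorphism_def intro: continuous_on_subset)
  have "ball x (\<delta> x) \<subseteq> K"
  proof
    fix y assume y: "y \<in> ball x (\<delta> x)"
    then have yU: "y \<in> U"
      using ball_infdist_compl_subset by blast
    have "dist (f x) (f y) \<le> H * dist x y powr \<alpha>"
      by (rule hoelder[OF x yU])
    also have "\<dots> \<le> H * \<delta> x powr \<alpha>"
      using y H_pos \<alpha>_pos by (intro mult_left_mono powr_mono2) auto
    finally have "g (f y) \<in> K"
      by (simp add: K_def)
    then show "y \<in> K"
      using homeo yU by (simp add: homeomorphism_def)
  qed
  then have "closure (ball x (\<delta> x)) \<subseteq> K"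
    using \<open>compact K\<close> by (simp add: closure_minimal compact_imp_closed)
  moreover have "K \<subseteq> U"
    using sub homeo by (auto simp: K_def homeomorphism_def)
  \<comment> \<open>As the radius is positive, the closure of the ball is the closed ball, which
    contains a nearest point of the complement.\<close>
  ultimately have "cball x (\<delta> x) \<subseteq> U"
    using \<delta>_pos[OF x] by simp
  moreover obtain z where "z \<in> - U" "\<delta> x = dist x z"
    using infdist_attains_inf[of "- U" x] open_U U_neq by auto
  ultimately show False
    by auto
qed

section \<open>Growth of the coefficients against decay of the Schwartz function\<close>

text \<open>Cauchy's inequality on the circle of radius \<open>\<delta> x / 2\<close>, where
  \<open>f\<close> is bounded because its values lie in \<open>V\<close>. Halving the radius keeps
  the closed disc inside \<open>U\<close> and causes the factor \<open>2 ^ n\<close>.\<close>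

lemma higher_deriv_bound:
  obtains C where "C \<ge> 0" "\<And>x. x \<in> U \<Longrightarrow> norm ((deriv ^^ n) f x) * \<delta> x ^ n \<le> C"
proof -
  obtain B where B: "\<And>y. y \<in> V \<Longrightarrow> norm y \<le> B" "B > 0"
    using bounded_V by (metis bounded_pos)
  show thesis
  proof
    show "0 \<le> fact n * B * 2 ^ n"
      using B by simp
    fix x assume x: "x \<in> U"
    have "cball x (\<delta> x / 2) \<subseteq> ball x (\<delta> x)"
      using \<delta>_pos[OF x] by (intro cball_subset_ball_iff[THEN iffD2]) simp
    then have sub: "cball x (\<delta> x / 2) \<subseteq> U"
      using ball_infdist_compl_subset by blast
    have "norm ((deriv ^^ n) f x) \<le> fact n * B / (\<delta> x / 2) ^ n"
    proof (rule Cauchy_inequality)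
      show "f holomorphic_on ball x (\<delta> x / 2)"
        using holo sub ball_subset_cball by (blast intro: holomorphic_on_subset)
      show "continuous_on (cball x (\<delta> x / 2)) f"
        using holo sub by (blast intro: holomorphic_on_imp_continuous_on continuous_on_subset)
      show "0 < \<delta> x / 2"
        using \<delta>_pos[OF x] by simp
      show "norm (f y) \<le> B" if "norm (x - y) = \<delta> x / 2" for y
        using sub that by (intro B f_in) (auto simp: dist_norm)
    qed
    moreover have "0 < (\<delta> x / 2) ^ n"
      using \<delta>_pos[OF x] by simp
    ultimately have "norm ((deriv ^^ n) f x) * (\<delta> x / 2) ^ n \<le> fact n * B"
      using pos_le_divide_eq by blast
    then have "norm ((deriv ^^ n) f x) * (\<delta> x / 2) ^ n * 2 ^ n \<le> fact n * B * 2 ^ n"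
      by (rule mult_right_mono) simp
    moreover have "(\<delta> x / 2) ^ n * 2 ^ n = \<delta> x ^ n"
      by (simp flip: power_mult_distrib)
    ultimately show "norm ((deriv ^^ n) f x) * \<delta> x ^ n \<le> fact n * B * 2 ^ n"
      by (simp only: mult.assoc)
  qed
qed

lemma conformal_coeff_bound:
  assumes "conformal_coeff f c"
  shows "\<exists>C k. 0 \<le> C \<and> (\<forall>x\<in>U. \<bar>c x\<bar> * \<delta> x ^ k \<le> C)"
  using assms
proof induction
  case one
  show ?case by (intro exI[of _ 1] exI[of _ 0]) simp
next
  case (deriv w n)
  obtain C where C: "C \<ge> 0" "\<And>x. x \<in> U \<Longrightarrow> norm ((deriv ^^ n) f x) * \<delta> x ^ n \<le> C"
    using higher_deriv_bound by blast
  have "\<bar>Re (w * (deriv ^^ n) f x)\<bar> * \<delta> x ^ n \<le> norm w * C" if "x \<in> U" for x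
  proof -
    have "\<bar>Re (w * (deriv ^^ n) f x)\<bar> * \<delta> x ^ n \<le> norm (w * (deriv ^^ n) f x) * \<delta> x ^ n"
      by (intro mult_right_mono abs_Re_le_cmod) (simp add: infdist_nonneg)
    also have "\<dots> = norm w * (norm ((deriv ^^ n) f x) * \<delta> x ^ n)"
      by (simp add: norm_mult)
    also have "\<dots> \<le> norm w * C"
      using C(2)[OF that] by (intro mult_left_mono) auto
    finally show ?thesis .
  qed
  with C(1) show ?case
    by (intro exI[of _ "norm w * C"] exI[of _ n]) simp
next
  case (add c d)
  then obtain C k D l where C: "0 \<le> C" "\<And>x. x \<in> U \<Longrightarrow> \<bar>c x\<bar> * \<delta> x ^ k \<le> C"
    and D: "0 \<le> D" "\<And>x. x \<in> U \<Longrightarrow> \<bar>d x\<bar> * \<delta> x ^ l \<le> D"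
    by blast
  obtain R where R: "R > 0" "\<And>x. x \<in> U \<Longrightarrow> \<delta> x \<le> R"
    using \<delta>_bounded by blast
  \<comment> \<open>The exponent \<open>k + l\<close> serves both summands; the surplus powers of
    \<delta> are at most \<open>R ^ l\<close> and \<open>R ^ k\<close>.\<close>
  have "\<bar>c x + d x\<bar> * \<delta> x ^ (k + l) \<le> C * R ^ l + D * R ^ k" if x: "x \<in> U" for x
  proof -
    have "\<bar>c x + d x\<bar> * \<delta> x ^ (k + l) \<le> (\<bar>c x\<bar> + \<bar>d x\<bar>) * \<delta> x ^ (k + l)"
      by (intro mult_right_mono) (auto simp: infdist_nonneg)
    also have "\<dots> = (\<bar>c x\<bar> * \<delta> x ^ k) * \<delta> x ^ l + (\<bar>d x\<bar> * \<delta> x ^ l) * \<delta> x ^ k"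
      by (simp add: power_add algebra_simps)
    also have "\<dots> \<le> C * R ^ l + D * R ^ k"
      using C D R x by (intro add_mono mult_mono power_mono) (auto simp: infdist_nonneg)
    finally show ?thesis .
  qed
  with C(1) D(1) R(1) show ?case
    by (intro exI[of _ "C * R ^ l + D * R ^ k"] exI[of _ "k + l"]) simp
next
  case (mult c d)
  then obtain C k D l where C: "0 \<le> C" "\<And>x. x \<in> U \<Longrightarrow> \<bar>c x\<bar> * \<delta> x ^ k \<le> C"
    and D: "0 \<le> D" "\<And>x. x \<in> U \<Longrightarrow> \<bar>d x\<bar> * \<delta> x ^ l \<le> D"
    by blast
  have "\<bar>c x * d x\<bar> * \<delta> x ^ (k + l) \<le> C * D" if x: "x \<in> U" for x
  proof -
    have "\<bar>c x * d x\<bar> * \<delta> x ^ (k + l) = (\<bar>c x\<bar> * \<delta> x ^ k) * (\<bar>d x\<bar> * \<delta> x ^ l)"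
      by (simp add: power_add abs_mult algebra_simps)
    also have "\<dots> \<le> C * D"
      using C D x by (intro mult_mono) (auto simp: infdist_nonneg)
    finally show ?thesis .
  qed
  with C(1) D(1) show ?case
    by (intro exI[of _ "C * D"] exI[of _ "k + l"]) simp
qed

text \<open>Any order of vanishing \<open>N\<close> is reached at the price of more derivatives of
  \<open>s\<close>: a coefficient grows at most like \<delta>^(-k), whereas derivatives of
  \<open>s\<close> at \<open>f x\<close> are O(\<delta>^(\<alpha> M)) for every M. That
  \<open>C\<close> and \<open>m\<close> do not depend on \<open>s\<close> later gives
  continuity.\<close>

lemma pullback_operator_bound:
  assumes "pullback_operator f F"
  shows "\<exists>C m. 0 \<le> C \<and> (\<forall>s\<in>schwartz_space_on V. \<forall>x\<in>U. \<bar>F s x\<bar> \<le> C * Cm_norm m s * \<delta> x ^ N)"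
  using assms
proof induction
  case (monomial c bs)
  obtain C k where C: "0 \<le> C" "\<And>x. x \<in> U \<Longrightarrow> \<bar>c x\<bar> * \<delta> x ^ k \<le> C"
    using conformal_coeff_bound[OF monomial(1)] by blast
  obtain R where R: "R > 0" "\<And>x. x \<in> U \<Longrightarrow> \<delta> x \<le> R"
    using \<delta>_bounded by blast
  \<comment> \<open>Of the exponent \<open>\<alpha> * M\<close>, which is at least
    \<open>k + N\<close>, the part \<open>k\<close> cancels the growth of \<open>c\<close>, the part
    \<open>N\<close> remains, and the surplus \<open>e\<close> is absorbed into
    \<open>R powr e\<close>.\<close>
  obtain M :: nat where M: "real (k + N) / \<alpha> \<le> real M"
    using real_arch_simple by blast
  define e where "e = \<alpha> * M - real (k + N)"
  have e: "0 \<le> e"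
    using M \<alpha>_pos by (simp add: e_def field_simps)
  \<comment> \<open>The factor \<open>2 ^ M\<close> comes from \<open>schwartz_decay\<close>, 2
    being the real dimension of the plane, and \<open>H ^ M\<close> from the Hoelder bound.\<close>
  define A where "A = C * (2 ^ M * H ^ M * R powr e)"
  have "\<bar>c x * iter_pderiv bs s (f x)\<bar> \<le> A * Cm_norm (length bs + M) s * \<delta> x ^ N"
    if s: "s \<in> schwartz_space_on V" and x: "x \<in> U" for s x
  proof -
    let ?S = "Cm_norm (length bs + M) s"
    have S: "0 \<le> ?S"
      using s by (intro Cm_norm_nonneg) (simp add: schwartz_space_on_def)
    have d: "0 < \<delta> x"
      by (rule \<delta>_pos[OF x])
    have "(\<delta> x powr \<alpha>) ^ M = \<delta> x powr (real (k + N) + e)"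
      using d by (simp add: powr_powr e_def flip: powr_realpow)
    also have "\<dots> = \<delta> x ^ k * \<delta> x ^ N * \<delta> x powr e"
      using d by (simp add: powr_add powr_realpow power_add)
    also have "\<dots> \<le> \<delta> x ^ k * \<delta> x ^ N * R powr e"
      using d e R(2)[OF x] by (intro mult_left_mono powr_mono2) auto
    finally have pw: "(\<delta> x powr \<alpha>) ^ M \<le> \<delta> x ^ k * \<delta> x ^ N * R powr e" .
    have "infdist (f x) (- V) ^ M \<le> (H * \<delta> x powr \<alpha>) ^ M"
      by (intro power_mono infdist_image_le x infdist_nonneg)
    also have "\<dots> = H ^ M * (\<delta> x powr \<alpha>) ^ M"
      by (rule power_mult_distrib)
    also have "\<dots> \<le> H ^ M * (\<delta> x ^ k * \<delta> x ^ N * R powr e)"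
      using H_pos by (intro mult_left_mono pw) auto
    finally have *: "2 ^ M * ?S * infdist (f x) (- V) ^ M
        \<le> 2 ^ M * ?S * (H ^ M * (\<delta> x ^ k * \<delta> x ^ N * R powr e))"
      using S by (intro mult_left_mono) auto
    have "\<bar>iter_pderiv bs s (f x)\<bar> \<le> 2 ^ M * ?S * infdist (f x) (- V) ^ M"
      using schwartz_decay[OF open_V V_neq s monomial(2), of "f x" M] by simp
    also note *
    finally have "\<bar>iter_pderiv bs s (f x)\<bar>
        \<le> 2 ^ M * ?S * (H ^ M * (\<delta> x ^ k * \<delta> x ^ N * R powr e))" .
    then have "\<bar>c x * iter_pderiv bs s (f x)\<bar>
        \<le> \<bar>c x\<bar> * (2 ^ M * ?S * (H ^ M * (\<delta> x ^ k * \<delta> x ^ N * R powr e)))"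
      unfolding abs_mult by (intro mult_left_mono) auto
    also have "\<dots> = \<bar>c x\<bar> * \<delta> x ^ k * (2 ^ M * H ^ M * R powr e * ?S * \<delta> x ^ N)"
      by (simp add: algebra_simps)
    also have "\<dots> \<le> C * (2 ^ M * H ^ M * R powr e * ?S * \<delta> x ^ N)"
      using S d H_pos by (intro mult_right_mono C x) auto
    finally show ?thesis
      by (simp add: A_def mult.assoc)
  qed
  moreover have "0 \<le> A"
    using C(1) H_pos by (simp add: A_def)
  ultimately show ?case
    by blast
next
  case (add F G)
  then obtain C m D n where
    C: "0 \<le> C" "\<And>s x. s \<in> schwartz_space_on V \<Longrightarrow> x \<in> U \<Longrightarrow> \<bar>F s x\<bar> \<le> C * Cm_norm m s * \<delta> x ^ N" and
    D: "0 \<le> D" "\<And>s x. s \<in> schwartz_space_on V \<Longrightarrow> x \<in> U \<Longrightarrow> \<bar>G s x\<bar> \<le> D * Cm_norm n s * \<delta> x ^ N"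
    by blast
  have "\<bar>F s x + G s x\<bar> \<le> (C + D) * Cm_norm (m + n) s * \<delta> x ^ N"
    if s: "s \<in> schwartz_space_on V" and x: "x \<in> U" for s x
  proof -
    have sS: "s \<in> schwartz_space"
      using s by (simp add: schwartz_space_on_def)
    have "C * Cm_norm m s * \<delta> x ^ N \<le> C * Cm_norm (m + n) s * \<delta> x ^ N"
      "D * Cm_norm n s * \<delta> x ^ N \<le> D * Cm_norm (m + n) s * \<delta> x ^ N"
      using C(1) D(1) Cm_norm_mono[OF sS]
      by (auto intro!: mult_right_mono mult_left_mono simp: infdist_nonneg)
    with C(2)[OF s x] D(2)[OF s x] show ?thesis
      by (simp add: algebra_simps)
  qed
  with C(1) D(1) show ?case
    by (intro exI[of _ "C + D"] exI[of _ "m + n"]) simp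
qed

section \<open>Differentiating the operators\<close>

text \<open>The directional derivative is recorded as one function \<open>c'\<close> of the same
  class, so that the rule can be iterated.\<close>

lemma conformal_coeff_deriv:
  assumes "conformal_coeff f c"
  shows "\<exists>c'. conformal_coeff f c' \<and> (\<forall>x\<in>U. \<exists>D. (c has_derivative D) (at x) \<and> D b = c' x)"
  using assms
proof induction
  case one
  \<comment> \<open>Zero is realised as a coefficient with \<open>w = 0\<close>.\<close>
  have "conformal_coeff f (\<lambda>x. Re (0 * (deriv ^^ 0) f x))"
    by (rule conformal_coeff.deriv)
  then show ?case
    by (intro exI[of _ "\<lambda>x. 0"]) (auto intro!: exI[of _ "\<lambda>x. 0"])
next
  case (deriv w n)
  have "((\<lambda>x. Re (w * (deriv ^^ n) f x)) has_derivative (\<lambda>h. Re (w * ((deriv ^^ Suc n) f x * h)))) (at x)"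
    if "x \<in> U" for x
    by (intro has_derivative_Re has_derivative_mult_right higher_deriv_has_derivative[OF holo open_U] that)
  \<comment> \<open>The direction \<open>b\<close> is absorbed into the constant.\<close>
  moreover have "conformal_coeff f (\<lambda>x. Re (w * b * (deriv ^^ Suc n) f x))"
    by (rule conformal_coeff.deriv)
  ultimately show ?case
    by (intro exI[of _ "\<lambda>x. Re (w * b * (deriv ^^ Suc n) f x)"]) (auto simp only: mult_ac)
next
  case (add c d)
  then obtain c' d' where "conformal_coeff f c'" "conformal_coeff f d'"
    and c': "\<forall>x\<in>U. \<exists>D. (c has_derivative D) (at x) \<and> D b = c' x"
    and d': "\<forall>x\<in>U. \<exists>D. (d has_derivative D) (at x) \<and> D b = d' x"
    by blast
  then have "conformal_coeff f (\<lambda>x. c' x + d' x)"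
    by (intro conformal_coeff.add)
  moreover have "\<forall>x\<in>U. \<exists>D. ((\<lambda>x. c x + d x) has_derivative D) (at x) \<and> D b = c' x + d' x"
  proof
    fix x assume "x \<in> U"
    then obtain D E where "(c has_derivative D) (at x)" "D b = c' x"
      "(d has_derivative E) (at x)" "E b = d' x"
      using c' d' by blast
    then show "\<exists>D. ((\<lambda>x. c x + d x) has_derivative D) (at x) \<and> D b = c' x + d' x"
      by (intro exI[of _ "\<lambda>h. D h + E h"]) (simp add: has_derivative_add)
  qed
  ultimately show ?case
    by blast
next
  case (mult c d)
  then obtain c' d' where "conformal_coeff f c'" "conformal_coeff f d'"
    and c': "\<forall>x\<in>U. \<exists>D. (c has_derivative D) (at x) \<and> D b = c' x"
    and d': "\<forall>x\<in>U. \<exists>D. (d has_derivative D) (at x) \<and> D b = d' x"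
    by blast
  then have "conformal_coeff f (\<lambda>x. c x * d' x + c' x * d x)"
    using mult.hyps by (intro conformal_coeff.add conformal_coeff.mult)
  moreover have "\<forall>x\<in>U. \<exists>D. ((\<lambda>x. c x * d x) has_derivative D) (at x) \<and> D b = c x * d' x + c' x * d x"
  proof
    fix x assume "x \<in> U"
    then obtain D E where "(c has_derivative D) (at x)" "D b = c' x"
      "(d has_derivative E) (at x)" "E b = d' x"
      using c' d' by blast
    then show "\<exists>D. ((\<lambda>x. c x * d x) has_derivative D) (at x) \<and> D b = c x * d' x + c' x * d x"
      by (intro exI[of _ "\<lambda>h. c x * E h + D h * d x"]) (simp add: has_derivative_mult)
  qed
  ultimately show ?case
    by blast
qed

text \<open>Product and chain rule: splitting the vector \<open>deriv f x * b\<close> along 1 and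
  \<i> produces two longer partial derivatives of \<open>s\<close>. \<open>G\<close> is chosen
  before \<open>s\<close>, which keeps later constants uniform in \<open>s\<close>.\<close>

lemma pullback_operator_deriv:
  assumes "pullback_operator f F"
  shows "\<exists>G. pullback_operator f G \<and> (\<forall>s\<in>schwartz_space. \<forall>x\<in>U. \<exists>D.
    (F s has_derivative D) (at x) \<and> D b = G s x)"
  using assms
proof induction
  case (monomial c bs)
  obtain c' where c': "conformal_coeff f c'"
    and Dc: "\<And>x. x \<in> U \<Longrightarrow> \<exists>D. (c has_derivative D) (at x) \<and> D b = c' x"
    using conformal_coeff_deriv[OF monomial(1)] by blast
  \<comment> \<open>The third coefficient contains the imaginary part of
    \<open>b * deriv f x\<close>, written as a real part after multiplication by
    \<open>- \<i>\<close>.\<close>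
  define G where "G = (\<lambda>s x. (c' x * iter_pderiv bs s (f x)
    + (c x * Re (b * (deriv ^^ 1) f x)) * iter_pderiv (1 # bs) s (f x))
    + (c x * Re (- \<i> * b * (deriv ^^ 1) f x)) * iter_pderiv (\<i> # bs) s (f x))"
  have "pullback_operator f G"
    unfolding G_def using monomial c'
    by (intro pullback_operator.intros conformal_coeff.intros) (auto simp: Basis_complex_def)
  moreover have "\<exists>D. ((\<lambda>x. c x * iter_pderiv bs s (f x)) has_derivative D) (at x) \<and> D b = G s x"
    if s: "s \<in> schwartz_space" and x: "x \<in> U" for s x
  proof -
    obtain D where D: "(c has_derivative D) (at x)" "D b = c' x"
      using Dc x by blast
    let ?E = "frechet_derivative (iter_pderiv bs s) (at (f x))"
    have E: "(iter_pderiv bs s has_derivative ?E) (at (f x))"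
      using s monomial(2)
      by (auto simp: schwartz_space_def smooth_on_def simp flip: frechet_derivative_works)
    have f': "(f has_derivative (\<lambda>h. deriv f x * h)) (at x)"
      using higher_deriv_has_derivative[OF holo open_U x, of 0] by simp
    have "((\<lambda>x. c x * iter_pderiv bs s (f x)) has_derivative
        (\<lambda>h. c x * ?E (deriv f x * h) + D h * iter_pderiv bs s (f x))) (at x)"
      by (intro has_derivative_mult D has_derivative_compose[OF f' E])
    moreover have E_eq: "?E (deriv f x * b)
        = Re (deriv f x * b) * ?E 1 + Im (deriv f x * b) * ?E \<i>"
    proof -
      have lin: "linear ?E"
        using E has_derivative_linear by blast
      have eq: "Re z *\<^sub>R 1 + Im z *\<^sub>R \<i> = z" for z
        by (simp add: complex_eq_iff)
      have "?E (Re z *\<^sub>R 1 + Im z *\<^sub>R \<i>) = Re z * ?E 1 + Im z * ?E \<i>" for z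
        by (simp only: linear_add[OF lin] linear_scale[OF lin] real_scaleR_def)
      then show ?thesis
        unfolding eq .
    qed
    moreover have "c x * ?E (deriv f x * b) + D b * iter_pderiv bs s (f x) = G s x"
      unfolding E_eq G_def by (simp add: D(2) algebra_simps)
    ultimately show ?thesis
      by (intro exI[of _ "\<lambda>h. c x * ?E (deriv f x * h) + D h * iter_pderiv bs s (f x)"] conjI)
  qed
  ultimately show ?case
    by blast
next
  case (add F G)
  then obtain F' G' where "pullback_operator f F'" "pullback_operator f G'"
    and F': "\<forall>s\<in>schwartz_space. \<forall>x\<in>U. \<exists>D. (F s has_derivative D) (at x) \<and> D b = F' s x"
    and G': "\<forall>s\<in>schwartz_space. \<forall>x\<in>U. \<exists>D. (G s has_derivative D) (at x) \<and> D b = G' s x"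
    by blast
  then have "pullback_operator f (\<lambda>s x. F' s x + G' s x)"
    by (intro pullback_operator.add)
  moreover have "\<forall>s\<in>schwartz_space. \<forall>x\<in>U. \<exists>D.
      ((\<lambda>x. F s x + G s x) has_derivative D) (at x) \<and> D b = F' s x + G' s x"
  proof (intro ballI)
    fix s :: "complex \<Rightarrow> real" and x assume "s \<in> schwartz_space" and "x \<in> U"
    then obtain D E where "(F s has_derivative D) (at x)" "D b = F' s x"
      "(G s has_derivative E) (at x)" "E b = G' s x"
      using F' G' by blast
    then show "\<exists>D. ((\<lambda>x. F s x + G s x) has_derivative D) (at x) \<and> D b = F' s x + G' s x"
      by (intro exI[of _ "\<lambda>h. D h + E h"]) (simp add: has_derivative_add)
  qed
  ultimately show ?case
    by blast
qed

section \<open>Smoothness and continuity of the pullback\<close>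

text \<open>The decay bound with exponent 2 is what extension by zero asks for, so differentiation
  commutes with that extension.\<close>

lemma pullback_operator_extend_zero:
  assumes F: "pullback_operator f F" and s: "s \<in> schwartz_space_on V"
    and G: "\<And>x. x \<in> U \<Longrightarrow> \<exists>D. (F s has_derivative D) (at x) \<and> D b = G x"
  shows "(\<lambda>x. if x \<in> U then F s x else 0) differentiable at x"
    and "frechet_derivative (\<lambda>x. if x \<in> U then F s x else 0) (at x) b = (if x \<in> U then G x else 0)"
proof -
  obtain C m where "\<And>x. x \<in> U \<Longrightarrow> \<bar>F s x\<bar> \<le> C * Cm_norm m s * \<delta> x ^ 2"
    using pullback_operator_bound[OF F, of 2] s by blast
  moreover obtain D where D: "\<And>x. x \<in> U \<Longrightarrow> (F s has_derivative D x) (at x) \<and> D x b = G x"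
    using G by metis
  ultimately have *: "((\<lambda>x. if x \<in> U then F s x else 0) has_derivative
      (if x \<in> U then D x else (\<lambda>_. 0))) (at x)"
    by (intro has_derivative_extend_zero[OF open_U]) auto
  then show "(\<lambda>x. if x \<in> U then F s x else 0) differentiable at x"
    by (auto simp: differentiable_def)
  show "frechet_derivative (\<lambda>x. if x \<in> U then F s x else 0) (at x) b = (if x \<in> U then G x else 0)"
    using D by (simp flip: frechet_derivative_at[OF *])
qed

text \<open>Each differentiation acts on the extended function, so the extension is carried through
  the induction. A single \<open>F\<close> serves all \<open>s\<close>.\<close>

lemma iter_pderiv_schwartz_pullback:
  assumes "set bs \<subseteq> Basis"
  shows "\<exists>F. pullback_operator f F \<and> (\<forall>s\<in>schwartz_space_on V.
    iter_pderiv bs (schwartz_pullback U f s) = (\<lambda>x. if x \<in> U then F s x else 0))"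
  using assms
proof (induction bs)
  case Nil
  have "pullback_operator f (\<lambda>s x. 1 * iter_pderiv [] s (f x))"
    by (intro pullback_operator.intros conformal_coeff.intros) simp
  then show ?case
    by (intro exI[of _ "\<lambda>s x. s (f x)"]) (simp add: schwartz_pullback_def)
next
  case (Cons b bs)
  then obtain F where F: "pullback_operator f F" and eq: "\<And>s. s \<in> schwartz_space_on V \<Longrightarrow>
      iter_pderiv bs (schwartz_pullback U f s) = (\<lambda>x. if x \<in> U then F s x else 0)"
    by auto
  obtain G where "pullback_operator f G" and G: "\<And>s x. s \<in> schwartz_space \<Longrightarrow> x \<in> U \<Longrightarrow>
      \<exists>D. (F s has_derivative D) (at x) \<and> D b = G s x"
    using pullback_operator_deriv[OF F] by blast
  have "iter_pderiv (b # bs) (schwartz_pullback U f s) = (\<lambda>x. if x \<in> U then G s x else 0)"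
    if s: "s \<in> schwartz_space_on V" for s
  proof -
    have "\<And>x. x \<in> U \<Longrightarrow> \<exists>D. (F s has_derivative D) (at x) \<and> D b = G s x"
      using G s by (simp add: schwartz_space_on_def)
    from pullback_operator_extend_zero(2)[OF F s this] show ?thesis
      by (simp add: eq[OF s])
  qed
  with \<open>pullback_operator f G\<close> show ?case
    by blast
qed

lemma schwartz_pullback_bound:
  assumes "set bs \<subseteq> Basis"
  obtains C m where "\<And>s x. s \<in> schwartz_space_on V \<Longrightarrow>
    norm x ^ k * \<bar>iter_pderiv bs (schwartz_pullback U f s) x\<bar> \<le> C * Cm_norm m s"
proof -
  obtain F where F: "pullback_operator f F" and eq: "\<And>s. s \<in> schwartz_space_on V \<Longrightarrow>
      iter_pderiv bs (schwartz_pullback U f s) = (\<lambda>x. if x \<in> U then F s x else 0)"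
    using iter_pderiv_schwartz_pullback[OF assms] by blast
  \<comment> \<open>Exponent 0 suffices, as the weight \<open>norm x ^ k\<close> is at most
    \<open>B ^ k\<close> on \<open>U\<close>.\<close>
  obtain C m where C: "0 \<le> C" "\<And>s x. s \<in> schwartz_space_on V \<Longrightarrow> x \<in> U \<Longrightarrow> \<bar>F s x\<bar> \<le> C * Cm_norm m s"
    using pullback_operator_bound[OF F, of 0] by auto
  obtain B where B: "\<And>x. x \<in> U \<Longrightarrow> norm x \<le> B" "B > 0"
    using bounded_U by (metis bounded_pos)
  have "norm x ^ k * \<bar>iter_pderiv bs (schwartz_pullback U f s) x\<bar> \<le> B ^ k * C * Cm_norm m s"
    if s: "s \<in> schwartz_space_on V" for s x
  proof (cases "x \<in> U")
    case True
    then have "norm x ^ k * \<bar>F s x\<bar> \<le> B ^ k * (C * Cm_norm m s)"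
      using B C(2)[OF s True] by (intro mult_mono power_mono) auto
    with True show ?thesis
      by (simp add: eq[OF s] mult.assoc)
  next
    case False
    \<comment> \<open>The left side is 0 here, so the sign of \<open>C\<close> matters.\<close>
    with s B C(1) show ?thesis
      by (simp add: eq[OF s] Cm_norm_nonneg schwartz_space_on_def)
  qed
  then show thesis
    by (rule that)
qed

lemma schwartz_pullback_in:
  assumes s: "s \<in> schwartz_space_on V"
  shows "schwartz_pullback U f s \<in> schwartz_space_on U"
proof -
  have "iter_pderiv bs (schwartz_pullback U f s) differentiable at x"
    and "x \<notin> U \<Longrightarrow> iter_pderiv bs (schwartz_pullback U f s) x = 0"
    if bs: "set bs \<subseteq> Basis" for bs x
  proof -
    obtain F where F: "pullback_operator f F" and
      eq: "iter_pderiv bs (schwartz_pullback U f s) = (\<lambda>x. if x \<in> U then F s x else 0)"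
      using iter_pderiv_schwartz_pullback[OF bs] s by blast
    obtain G where "\<And>x. x \<in> U \<Longrightarrow> \<exists>D. (F s has_derivative D) (at x) \<and> D 1 = G s x"
      using pullback_operator_deriv[OF F] s by (force simp: schwartz_space_on_def)
    from pullback_operator_extend_zero(1)[OF F s this]
    show "iter_pderiv bs (schwartz_pullback U f s) differentiable at x"
      by (simp add: eq)
    show "x \<notin> U \<Longrightarrow> iter_pderiv bs (schwartz_pullback U f s) x = 0"
      by (simp add: eq)
  qed
  moreover have "bounded (range (\<lambda>x. norm x ^ k * \<bar>iter_pderiv bs (schwartz_pullback U f s) x\<bar>))"
    if bs: "set bs \<subseteq> Basis" for k bs
  proof -
    obtain C m where "\<And>s x. s \<in> schwartz_space_on V \<Longrightarrow>
        norm x ^ k * \<bar>iter_pderiv bs (schwartz_pullback U f s) x\<bar> \<le> C * Cm_norm m s"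
      using schwartz_pullback_bound[OF bs] by blast
    with s show ?thesis
      unfolding bounded_iff by (intro exI[of _ "C * Cm_norm m s"]) (simp add: abs_mult)
  qed
  ultimately show ?thesis
    by (simp add: schwartz_space_on_def schwartz_space_def smooth_on_def)
qed

lemma continuous_map_schwartz_pullback:
  "continuous_map (schwartz_topology_on V) (schwartz_topology_on U) (schwartz_pullback U f)"
proof (rule continuous_map_schwartz_on)
  show "\<And>s. s \<in> schwartz_space_on V \<Longrightarrow> schwartz_pullback U f s \<in> schwartz_space_on U"
    by (rule schwartz_pullback_in)
  show "\<And>s t. schwartz_pullback U f (\<lambda>x. s x - t x)
      = (\<lambda>x. schwartz_pullback U f s x - schwartz_pullback U f t x)"
    by (auto simp: schwartz_pullback_def)
  fix k and bs :: "complex list"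
  assume "set bs \<subseteq> Basis"
  then obtain C m where "\<And>s x. s \<in> schwartz_space_on V \<Longrightarrow>
      norm x ^ k * \<bar>iter_pderiv bs (schwartz_pullback U f s) x\<bar> \<le> C * Cm_norm m s"
    using schwartz_pullback_bound by blast
  then show "\<exists>C m. \<forall>s\<in>schwartz_space_on V.
      schwartz_seminorm k bs (schwartz_pullback U f s) \<le> C * Cm_norm m s"
    unfolding schwartz_seminorm_def by (intro exI ballI cSUP_least) auto
qed

end

section \<open>The inverse map and the conclusion\<close>

text \<open>Off \<open>V\<close> the composite is zero by construction, and \<open>s\<close>
  vanishes there by the condition for the empty list.\<close>

lemma schwartz_pullback_inverse:
  assumes "homeomorphism U V f g" and "s \<in> schwartz_space_on V"
  shows "schwartz_pullback V g (schwartz_pullback U f s) = s"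
proof
  fix y
  show "schwartz_pullback V g (schwartz_pullback U f s) y = s y"
  proof (cases "y \<in> V")
    case False
    from assms(2) have "\<forall>bs. set bs \<subseteq> Basis \<longrightarrow> (\<forall>x. x \<notin> V \<longrightarrow> iter_pderiv bs s x = 0)"
      by (simp add: schwartz_space_on_def)
    from this[rule_format, of "[]" y] False show ?thesis
      by (simp add: schwartz_pullback_def)
  qed (use assms(1) in \<open>auto simp: schwartz_pullback_def homeomorphism_def\<close>)
qed

text \<open>The derivative of a holomorphic function in a direction is its complex derivative times
  that direction, so iterated partials are constant multiples of higher complex derivatives. This
  holds on \<open>U\<close> only, whence the transfer along the open set.\<close>

lemma holomorphic_imp_smooth_on:
  assumes "f holomorphic_on U" and "open U"
  shows "smooth_on U f"
proof -
  have der: "((\<lambda>x. w * (deriv ^^ n) f x) has_derivative (\<lambda>h. w * (deriv ^^ Suc n) f x * h)) (at x)"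
    if "x \<in> U" for w x and n
    using has_derivative_mult_right[OF higher_deriv_has_derivative[OF assms that], of w]
    by (simp add: mult.assoc)
  \<comment> \<open>The witness \<open>w\<close> is the product of the entries of
    \<open>bs\<close>.\<close>
  have *: "\<exists>w. \<forall>x\<in>U. iter_pderiv bs f x = w * (deriv ^^ length bs) f x" for bs
  proof (induction bs)
    case Nil
    show ?case by (intro exI[of _ 1]) simp
  next
    case (Cons b bs)
    then obtain w where w: "\<And>x. x \<in> U \<Longrightarrow> iter_pderiv bs f x = w * (deriv ^^ length bs) f x"
      by blast
    have "iter_pderiv (b # bs) f x = w * b * (deriv ^^ length (b # bs)) f x" if "x \<in> U" for x
    proof -
      have "(iter_pderiv bs f has_derivative (\<lambda>h. w * (deriv ^^ Suc (length bs)) f x * h)) (at x)"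
        using has_derivative_transform_within_open[OF der[OF that] assms(2) that] w by simp
      from frechet_derivative_at[OF this, symmetric] show ?thesis
        by simp
    qed
    then show ?case by blast
  qed
  show ?thesis
    unfolding smooth_on_def
  proof (intro allI impI ballI)
    fix bs x assume x: "x \<in> U"
    obtain w where w: "\<And>x. x \<in> U \<Longrightarrow> iter_pderiv bs f x = w * (deriv ^^ length bs) f x"
      using * by blast
    show "iter_pderiv bs f differentiable at x"
      using has_derivative_transform_within_open[OF der[OF x] assms(2) x] w
      by (metis differentiable_def)
  qed
qed

theorem theorem3p4:
  fixes U V :: "complex set" and \<phi> :: "complex \<Rightarrow> complex"
  assumes "planar_domain U" and "bounded U"
    and "planar_domain V" and "bounded V"
    and "conformal_map U V \<phi>"
    and "bi_hoelder U V \<phi>"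
  shows "schwartz_equivalent U V"
proof -
  let ?\<psi> = "inv_into U \<phi>"
  have op: "open U" "open V" and bij: "bij_betw \<phi> U V"
    and holo: "\<phi> holomorphic_on U" "?\<psi> holomorphic_on V"
    using assms by (auto simp: planar_domain_def conformal_map_def)
  have homeo: "homeomorphism U V \<phi> ?\<psi>"
    using bij holo bij_betw_inv_into[OF bij]
    by (auto simp: homeomorphism_def holomorphic_on_imp_continuous_on bij_betw_imp_surj_on
        bij_betw_inv_into_left bij_betw_inv_into_right)
  obtain C a where C: "C > 0" "a > 0"
    "\<And>x y. x \<in> U \<Longrightarrow> y \<in> U \<Longrightarrow> dist (\<phi> x) (\<phi> y) \<le> C * dist x y powr a"
    using assms(6) unfolding bi_hoelder_def hoelder_on_def by blast
  obtain D b where D: "D > 0" "b > 0"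
    "\<And>x y. x \<in> V \<Longrightarrow> y \<in> V \<Longrightarrow> dist (?\<psi> x) (?\<psi> y) \<le> D * dist x y powr b"
    using assms(6) unfolding bi_hoelder_def hoelder_on_def by blast
  interpret \<phi>: hoelder_conformal U V \<phi> ?\<psi> C a
    by unfold_locales (use op assms homeo holo C in auto)
  \<comment> \<open>Exchanging the roles gives continuity of the inverse pullback.\<close>
  interpret \<psi>: hoelder_conformal V U ?\<psi> \<phi> D b
    by unfold_locales (use op assms homeomorphism_symD[OF homeo] holo D in auto)
  have "homeomorphic_maps (schwartz_topology_on V) (schwartz_topology_on U)
      (schwartz_pullback U \<phi>) (schwartz_pullback V ?\<psi>)"
    unfolding homeomorphic_maps_def topspace_schwartz_topology_on
    using \<phi>.continuous_map_schwartz_pullback \<psi>.continuous_map_schwartz_pullback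
      schwartz_pullback_inverse[OF homeo] schwartz_pullback_inverse[OF homeomorphism_symD[OF homeo]]
    by blast
  then have "tvs_isomorphism (schwartz_topology_on V) (schwartz_topology_on U) (schwartz_pullback U \<phi>)"
    unfolding tvs_isomorphism_def homeomorphic_map_maps
    by (auto simp: schwartz_pullback_def)
  moreover have "diffeomorphism_betw U V \<phi>"
    unfolding diffeomorphism_betw_def using bij holo op by (simp add: holomorphic_imp_smooth_on)
  ultimately show ?thesis
    unfolding schwartz_equivalent_def using op by blast
qed

end
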